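(* For all integers $p,q\ge 2$, each of the three words $ABA^pB^q$, $ABBABA^pB^q$ and $ABABA^pB^q$ can have negative trace when evaluated at positive definite matrices, and the fixed pair $A_1,B_1$ (independent of $p$ and $q$) shows this: for all integers $p,q\ge 2$, substituting $A=A_1$, $B=B_1$ gives $\operatorname{Tr}(ABA^pB^q)<0$, $\operatorname{Tr}(ABBABA^pB^q)<0$ and $\operatorname{Tr}(ABABA^pB^q)<0$.
   Context: A word in the letters $A,B$ is interpreted as the matrix product obtained by substituting positive definite matrices for the letters; exponents denote repeated letters (matrix powers). The matrices $A_1,B_1$ are the real symmetric positive definite matrices $$A_1=\begin{bmatrix}1&20&210\\20&402&4240\\210&4240&44903\end{bmatrix},\qquad B_1=\begin{bmatrix}36501&-3820&190\\-3820&401&-20\\190&-20&1\end{bmatrix},$$ which also give the word $(BA)(BA)(AB)$ a negative trace. *)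

theory Defs
  imports Complex_Main "Jordan_Normal_Form.Matrix"
begin

datatype letter = LetA | LetB

text \<open>The size parameter is needed only to make the empty word the identity matrix.\<close>

fun eval_word :: "nat \<Rightarrow> real mat \<Rightarrow> real mat \<Rightarrow> letter list \<Rightarrow> real mat" where
  "eval_word n A B [] = 1\<^sub>m n"
| "eval_word n A B (LetA # w) = A * eval_word n A B w"
| "eval_word n A B (LetB # w) = B * eval_word n A B w"

definition mat_trace :: "real mat \<Rightarrow> real" where
  "mat_trace M = (\<Sum>i<dim_row M. M $$ (i, i))"

definition positive_definite :: "nat \<Rightarrow> real mat \<Rightarrow> bool" where
  "positive_definite n M \<longleftrightarrow>
     M \<in> carrier_mat n n \<and> transpose_mat M = M \<and>
     (\<forall>v \<in> carrier_vec n. v \<noteq> 0\<^sub>v n \<longrightarrow> v \<bullet> (M *\<^sub>v v) > 0)"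

definition can_have_negative_trace :: "letter list \<Rightarrow> bool" where
  "can_have_negative_trace w \<longleftrightarrow>
     (\<exists>n A B. positive_definite n A \<and> positive_definite n B \<and>
        mat_trace (eval_word n A B w) < 0)"

definition A1 :: "real mat" where
  "A1 = mat_of_rows_list 3
     [[  1,   20,   210],
      [ 20,  402,  4240],
      [210, 4240, 44903]]"

definition B1 :: "real mat" where
  "B1 = mat_of_rows_list 3
     [[36501, -3820, 190],
      [-3820,   401, -20],
      [  190,   -20,   1]]"

definition word_ABApBq :: "nat \<Rightarrow> nat \<Rightarrow> letter list" where
  "word_ABApBq p q = [LetA, LetB] @ replicate p LetA @ replicate q LetB"

definition word_ABBABApBq :: "nat \<Rightarrow> nat \<Rightarrow> letter list" where
  "word_ABBABApBq p q = [LetA, LetB, LetB, LetA, LetB] @ replicate p LetA @ replicate q LetB"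

definition word_ABABApBq :: "nat \<Rightarrow> nat \<Rightarrow> letter list" where
  "word_ABABApBq p q = [LetA, LetB, LetA, LetB] @ replicate p LetA @ replicate q LetB"

end

theory Submission
  imports Defs
begin

text \<open>
  By the Cayley--Hamilton theorem every power of a \<open>3 \<times> 3\<close> matrix \<open>X\<close> has the form
  \<open>u X\<^sup>2 - v X + w\<close>. If the characteristic polynomial is \<open>x\<^sup>3 - t x\<^sup>2 + s x - d\<close>, multiplication by
  \<open>X\<close> sends \<open>(u, v, w)\<close> to \<open>(t u - v, s u - w, d u)\<close>; this is \<open>A1_times_quad\<close> and \<open>B1_times_quad\<close>.
  The coefficients of \<open>A1\<close> are \<open>(t, s, d) = (45306, 74211, 6)\<close>, and those of \<open>B1\<close> are
  \<open>(36903, 44903, 1)\<close>. Their size makes the map preserve a narrow polyhedral cone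
  \<open>0 \<le> r w \<le> v \<le> c u\<close> (\<open>cone_step\<close>), and \<open>X\<^sup>2 = (1, 0, 0)\<close> lies in it. So all the powers
  with exponent at least 2 stay in one cone that is spanned by just three rays.

  For a fixed prefix \<open>h\<close> the trace of \<open>h A\<^sup>p B\<^sup>q\<close> is bilinear in the coordinates of \<open>A\<^sup>p\<close> and
  \<open>B\<^sup>q\<close>. A bilinear form that is negative on all nine pairs of rays is negative on the
  product of the cones. This reduces each of the three families of words to nine
  numerical inequalities, independent of \<open>p\<close> and \<open>q\<close>; \<open>cone_functional_neg\<close> organises
  them one factor at a time.

  The parameter \<open>r\<close> is squeezed from both sides. It cannot exceed \<open>s / d\<close>, for otherwise the
  cone is not invariant. On the other hand the ray \<open>X\<^sup>2 - c X + c / r\<close> contains the identity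
  with weight \<open>c / r\<close>, and the identity paired with the square of the other matrix gives, for
  the prefix \<open>AB\<close> for example, a trace of more than \<open>10\<^sup>9\<close>; for small \<open>r\<close> this term wins.
  The values \<open>r = 12350 < 74211 / 6\<close> for \<open>A1\<close>, \<open>r = 44000 < 44903\<close> for \<open>B1\<close> and
  \<open>c = 2\<close> for both satisfy all requirements.
\<close>

section \<open>Arithmetic of explicit 3 by 3 matrices\<close>

abbreviation mat3 :: "'a \<Rightarrow> 'a \<Rightarrow> 'a \<Rightarrow> 'a \<Rightarrow> 'a \<Rightarrow> 'a \<Rightarrow> 'a \<Rightarrow> 'a \<Rightarrow> 'a \<Rightarrow> 'a mat" where
  "mat3 a b c d e f g h i \<equiv> mat_of_rows_list 3 [[a, b, c], [d, e, f], [g, h, i]]"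

lemmas mat3_entries = mat_of_rows_list_def less_Suc_eq numeral_3_eq_3 numeral_2_eq_2

lemma mat3_mult:
  fixes a :: "'a :: comm_ring_1"
  shows "mat3 a b c d e f g h i * mat3 a' b' c' d' e' f' g' h' i' =
    mat3 (a * a' + b * d' + c * g') (a * b' + b * e' + c * h') (a * c' + b * f' + c * i')
         (d * a' + e * d' + f * g') (d * b' + e * e' + f * h') (d * c' + e * f' + f * i')
         (g * a' + h * d' + i * g') (g * b' + h * e' + i * h') (g * c' + h * f' + i * i')"
  by (rule eq_matI)
     (auto simp: mat3_entries scalar_prod_def)

lemma mat3_one: "1\<^sub>m 3 = mat3 1 0 0 0 1 0 0 0 1"
  by (rule eq_matI) (auto simp: mat3_entries)

lemma mat3_add:
  "mat3 a b c d e f g h i + mat3 a' b' c' d' e' f' g' h' i' =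
    mat3 (a + a') (b + b') (c + c') (d + d') (e + e') (f + f') (g + g') (h + h') (i + i')"
  by (rule eq_matI) (auto simp: mat3_entries)

lemma mat3_smult:
  "k \<cdot>\<^sub>m mat3 a b c d e f g h i =
    mat3 (k * a) (k * b) (k * c) (k * d) (k * e) (k * f) (k * g) (k * h) (k * i)"
  by (rule eq_matI) (auto simp: mat3_entries)

lemma mat_trace_mat3: "mat_trace (mat3 a b c d e f g h i) = a + e + i"
  by (simp add: mat_trace_def mat3_entries)

lemmas mat3_simps = mat3_mult mat3_one mat3_add mat3_smult mat_trace_mat3

section \<open>Positive definiteness\<close>

lemma positive_definite_mat3I:
  assumes "\<And>x y z. (x, y, z) \<noteq> (0, 0, 0) \<Longrightarrow>
    a * x\<^sup>2 + d * y\<^sup>2 + f * z\<^sup>2 + 2 * b * x * y + 2 * c * x * z + 2 * e * y * z > 0"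
  shows "positive_definite 3 (mat3 a b c b d e c e f)"
  unfolding positive_definite_def
proof (intro conjI ballI impI)
  show "mat3 a b c b d e c e f \<in> carrier_mat 3 3"
    by (simp add: mat3_entries)
  show "transpose_mat (mat3 a b c b d e c e f) = mat3 a b c b d e c e f"
    by (rule eq_matI) (auto simp: mat3_entries)
next
  fix v :: "real vec"
  assume v: "v \<in> carrier_vec 3" and "v \<noteq> 0\<^sub>v 3"
  then have "(v $ 0, v $ 1, v $ 2) \<noteq> (0, 0, 0)"
    by (auto simp: less_Suc_eq numeral_3_eq_3 numeral_2_eq_2 intro!: eq_vecI)
  then have "a * (v $ 0)\<^sup>2 + d * (v $ 1)\<^sup>2 + f * (v $ 2)\<^sup>2
      + 2 * b * v $ 0 * v $ 1 + 2 * c * v $ 0 * v $ 2 + 2 * e * v $ 1 * v $ 2 > 0"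
    by (rule assms)
  also have "a * (v $ 0)\<^sup>2 + d * (v $ 1)\<^sup>2 + f * (v $ 2)\<^sup>2
      + 2 * b * v $ 0 * v $ 1 + 2 * c * v $ 0 * v $ 2 + 2 * e * v $ 1 * v $ 2
      = v \<bullet> (mat3 a b c b d e c e f *\<^sub>v v)"
    using v
    by (simp add: mat3_entries scalar_prod_def
        algebra_simps power2_eq_square)
  finally show "v \<bullet> (mat3 a b c b d e c e f *\<^sub>v v) > 0" .
qed

lemma positive_definite_A1: "positive_definite 3 A1"
  unfolding A1_def
proof (rule positive_definite_mat3I)
  fix x y z :: real
  assume "(x, y, z) \<noteq> (0, 0, 0)"
  then have "(x + 20 * y + 210 * z)\<^sup>2 + 2 * (y + 20 * z)\<^sup>2 + 3 * z\<^sup>2 > 0"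
    by (cases "z = 0"; cases "y = 0") (auto simp: add_nonneg_pos add_pos_nonneg)
  then show "1 * x\<^sup>2 + 402 * y\<^sup>2 + 44903 * z\<^sup>2
      + 2 * 20 * x * y + 2 * 210 * x * z + 2 * 4240 * y * z > 0"
    by (simp add: power2_eq_square algebra_simps)
qed

text \<open>
  Elimination from the last coordinate, where the entry of \<open>B1\<close> is 1, keeps the coefficients of the
  squares integral.
\<close>
lemma positive_definite_B1: "positive_definite 3 B1"
  unfolding B1_def
proof (rule positive_definite_mat3I)
  fix x y z :: real
  assume "(x, y, z) \<noteq> (0, 0, 0)"
  then have "(190 * x - 20 * y + z)\<^sup>2 + (y - 20 * x)\<^sup>2 + x\<^sup>2 > 0"
    by (cases "x = 0"; cases "y = 0") (auto simp: add_nonneg_pos add_pos_nonneg)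
  then show "36501 * x\<^sup>2 + 401 * y\<^sup>2 + 1 * z\<^sup>2
      + 2 * (- 3820) * x * y + 2 * 190 * x * z + 2 * (- 20) * y * z > 0"
    by (simp add: power2_eq_square algebra_simps)
qed

section \<open>An invariant cone for the powers of a matrix\<close>

text \<open>
  The triple \<open>(u, v, w)\<close> stands for \<open>u X\<^sup>2 - v X + w\<close>. The closed cone has the rays \<open>X\<^sup>2\<close>,
  \<open>X\<^sup>2 - c X\<close> and \<open>X\<^sup>2 - c X + c / r\<close>; the condition \<open>0 < u\<close> removes the apex,
  so that strict inequalities on the rays give strict ones inside.
\<close>
definition cone :: "real \<Rightarrow> real \<Rightarrow> real \<Rightarrow> real \<Rightarrow> real \<Rightarrow> bool" where
  "cone c r u v w \<longleftrightarrow> 0 < u \<and> 0 \<le> w \<and> r * w \<le> v \<and> v \<le> c * u"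

text \<open>
  Since \<open>w \<le> (c / r) u\<close> and \<open>v \<le> c u\<close> in the cone, each new coordinate is estimated by a
  multiple of \<open>u\<close> alone. The hypotheses on \<open>s\<close> compare these multiples: one keeps the new
  \<open>v\<close> at least \<open>r\<close> times the new \<open>w\<close>, the other keeps it at most \<open>c\<close> times the new \<open>u\<close>.
\<close>
lemma cone_step:
  assumes cone: "cone c r u v w" and pos: "0 < c" "0 < r" "0 < s" "0 \<le> d"
    and low: "r * d + c / r \<le> s" and high: "s \<le> c * (t - c)"
  shows "cone c r (t * u - v) (s * u - w) (d * u)"
proof -
  have u: "0 < u" and w: "0 \<le> w" and wv: "r * w \<le> v" and vu: "v \<le> c * u"
    using cone by (auto simp: cone_def)
  have "0 < c * (t - c)" using pos high by linarith
  then have "0 < t - c" using pos(1) zero_less_mult_pos by blast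
  then have "0 < (t - c) * u" using u by simp
  then have 1: "0 < t * u - v" using vu by (simp add: algebra_simps)
  have "r * w \<le> c * u" using wv vu by linarith
  then have "w \<le> c / r * u" using pos by (simp add: field_simps)
  moreover have "(r * d + c / r) * u \<le> s * u"
    using low u by (intro mult_right_mono) auto
  ultimately have 2: "r * (d * u) \<le> s * u - w" by (simp add: algebra_simps)
  have "s * u \<le> c * (t - c) * u" using high u by (intro mult_right_mono) auto
  moreover have "c * v \<le> c * (c * u)" using vu pos by (intro mult_left_mono) auto
  ultimately have 3: "s * u - w \<le> c * (t * u - v)" using w by (simp add: algebra_simps)
  show ?thesis using 1 2 3 u pos by (simp add: cone_def)
qed

text \<open>
  The three sign conditions are the values of the functional on the rays (the last one
  multiplied by \<open>r\<close>). A point of the cone is a combination of the rays with the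
  nonnegative weights \<open>u - v / c\<close>, \<open>v / c - r w / c\<close> and \<open>r w / c\<close>, not all zero as their
  sum is \<open>u\<close>.
\<close>
lemma cone_functional_neg:
  assumes cone: "cone c r u v w" and pos: "0 < c" "0 < r"
    and a: "a < 0" and b: "a - c * b < 0" and g: "r * (a - c * b) + c * g < 0"
  shows "a * u - b * v + g * w < 0"
proof -
  have u: "0 < u" and w: "0 \<le> w" and wv: "r * w \<le> v" and vu: "v \<le> c * u"
    using cone by (auto simp: cone_def)
  have "c * (a * u - b * v + g * w) =
      a * (c * u - v) + (a - c * b) * (v - r * w) + (r * (a - c * b) + c * g) * w"
    by (simp add: algebra_simps)
  also have "\<dots> < 0"
  proof (cases "v < c * u")
    case True
    then have "a * (c * u - v) < 0" using a by (simp add: mult_neg_pos)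
    moreover have "(a - c * b) * (v - r * w) \<le> 0"
      using b wv by (intro mult_nonpos_nonneg) auto
    moreover have "(r * (a - c * b) + c * g) * w \<le> 0"
      using g w by (intro mult_nonpos_nonneg) auto
    ultimately show ?thesis by linarith
  next
    case False
    then have v: "v = c * u" using vu by simp
    then have "0 < v" using u pos by simp
    then have "r * w < v \<or> 0 < w" using w by (cases "w = 0") auto
    then have "(a - c * b) * (v - r * w) < 0 \<or> (r * (a - c * b) + c * g) * w < 0"
      using b g by (auto simp: mult_neg_pos)
    moreover have "(a - c * b) * (v - r * w) \<le> 0"
      using b wv by (intro mult_nonpos_nonneg) auto
    moreover have "(r * (a - c * b) + c * g) * w \<le> 0"
      using g w by (intro mult_nonpos_nonneg) auto
    ultimately show ?thesis using v by auto
  qed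
  finally show ?thesis using pos by (simp add: mult_less_0_iff)
qed

section \<open>The powers of A1 and B1 in cone coordinates\<close>

definition quad :: "real mat \<Rightarrow> real \<Rightarrow> real \<Rightarrow> real \<Rightarrow> real mat" where
  "quad X u v w = u \<cdot>\<^sub>m (X * X) + (- v) \<cdot>\<^sub>m X + w \<cdot>\<^sub>m 1\<^sub>m 3"

text \<open>
  The Cayley--Hamilton relation \<open>A1\<^sup>3 = 45306 A1\<^sup>2 - 74211 A1 + 6\<close>, applied to a general element
  of the span of \<open>A1\<^sup>2\<close>, \<open>A1\<close> and 1.
\<close>
lemma A1_times_quad:
  "A1 * quad A1 u v w = quad A1 (45306 * u - v) (74211 * u - w) (6 * u)"
  unfolding quad_def A1_def mat3_simps by (simp add: algebra_simps)

text \<open>The same for \<open>B1\<^sup>3 = 36903 B1\<^sup>2 - 44903 B1 + 1\<close>.\<close>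
lemma B1_times_quad:
  "B1 * quad B1 u v w = quad B1 (36903 * u - v) (44903 * u - w) (1 * u)"
  unfolding quad_def B1_def mat3_simps by (simp add: algebra_simps)

lemma power_A1:
  assumes "p \<ge> 2"
  shows "\<exists>u v w. cone 2 12350 u v w \<and>
    eval_word 3 A1 B1 (replicate p LetA) = quad A1 u v w"
  using assms
proof (induction p rule: dec_induct)
  case base
  have "eval_word 3 A1 B1 (replicate 2 LetA) = quad A1 1 0 0"
    unfolding quad_def A1_def by (simp add: numeral_2_eq_2 mat3_simps)
  moreover have "cone 2 12350 1 0 0" by (simp add: cone_def)
  ultimately show ?case by blast
next
  case (step p)
  then obtain u v w where "cone 2 12350 u v w"
    and "eval_word 3 A1 B1 (replicate p LetA) = quad A1 u v w" by blast
  moreover from this have "cone 2 12350 (45306 * u - v) (74211 * u - w) (6 * u)"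
    by (intro cone_step) auto
  ultimately show ?case by (auto simp: A1_times_quad)
qed

lemma power_B1:
  assumes "q \<ge> 2"
  shows "\<exists>u v w. cone 2 44000 u v w \<and>
    eval_word 3 A1 B1 (replicate q LetB) = quad B1 u v w"
  using assms
proof (induction q rule: dec_induct)
  case base
  have "eval_word 3 A1 B1 (replicate 2 LetB) = quad B1 1 0 0"
    unfolding quad_def B1_def by (simp add: numeral_2_eq_2 mat3_simps)
  moreover have "cone 2 44000 1 0 0" by (simp add: cone_def)
  ultimately show ?case by blast
next
  case (step q)
  then obtain u v w where "cone 2 44000 u v w"
    and "eval_word 3 A1 B1 (replicate q LetB) = quad B1 u v w" by blast
  moreover from this have "cone 2 44000 (36903 * u - v) (44903 * u - w) (1 * u)"
    by (intro cone_step) auto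
  ultimately show ?case by (auto simp: B1_times_quad)
qed

section \<open>Negativity of the traces\<close>

lemma eval_word_carrier:
  assumes "A \<in> carrier_mat n n" "B \<in> carrier_mat n n"
  shows "eval_word n A B w \<in> carrier_mat n n"
proof (induction w)
  case (Cons l w)
  then show ?case using assms by (cases l) auto
qed simp

lemma eval_word_append:
  assumes "A \<in> carrier_mat n n" "B \<in> carrier_mat n n"
  shows "eval_word n A B (v @ w) = eval_word n A B v * eval_word n A B w"
proof (induction v)
  case Nil
  show ?case using eval_word_carrier[OF assms, of w] by simp
next
  case (Cons l v)
  have "X * (eval_word n A B v * eval_word n A B w) =
      X * eval_word n A B v * eval_word n A B w" if "X \<in> carrier_mat n n" for X
    by (rule assoc_mult_mat[symmetric, OF that])
       (rule eval_word_carrier[OF assms])+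
  then show ?case using Cons assms by (cases l) auto
qed

text \<open>
  The exponents disappear here: what remains is one inequality on a product of two cones
  for each prefix \<open>h\<close>.
\<close>
lemma trace_word_neg:
  assumes pq: "p \<ge> 2" "q \<ge> 2"
    and neg: "\<And>u v w x y z. cone 2 12350 u v w \<Longrightarrow> cone 2 44000 x y z \<Longrightarrow>
      mat_trace (eval_word 3 A1 B1 h * (quad A1 u v w * quad B1 x y z)) < 0"
  shows "mat_trace (eval_word 3 A1 B1 (h @ replicate p LetA @ replicate q LetB)) < 0"
proof -
  have "A1 \<in> carrier_mat 3 3" "B1 \<in> carrier_mat 3 3"
    using positive_definite_A1 positive_definite_B1 by (auto simp: positive_definite_def)
  note append = eval_word_append[OF this]
  show ?thesis
    using power_A1[OF pq(1)] power_B1[OF pq(2)] neg by (auto simp: append)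
qed

lemma quad_A1: "quad A1 u v w =
  mat3 (44501 * u - v + w) (898460 * u - 20 * v) (9514640 * u - 210 * v)
       (898460 * u - 20 * v) (18139604 * u - 402 * v + w) (192097400 * u - 4240 * v)
       (9514640 * u - 210 * v) (192097400 * u - 4240 * v) (2034301109 * u - 44903 * v + w)"
  unfolding quad_def A1_def mat3_simps by (simp add: algebra_simps)

lemma quad_B1: "quad B1 u v w =
  mat3 (1346951501 * u - 36501 * v + w) (- 140969440 * u + 3820 * v) (7011780 * u - 190 * v)
       (- 140969440 * u + 3820 * v) (14753601 * u - 401 * v + w) (- 733840 * u + 20 * v)
       (7011780 * u - 190 * v) (- 733840 * u + 20 * v) (36501 * u - v + w)"
  unfolding quad_def B1_def mat3_simps by (simp add: algebra_simps)

lemma word_AB: "eval_word 3 A1 B1 [LetA, LetB] =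
  mat3 1 0 0 (- 20) 2 0 (- 20) (- 20) 3"
  unfolding A1_def B1_def by (simp add: mat3_simps)

text \<open>
  In the coordinates \<open>x\<close>, \<open>y\<close>, \<open>z\<close> of the second factor the trace is a linear functional whose
  coefficients are linear in \<open>u\<close>, \<open>v\<close>, \<open>w\<close>. The coefficient attached to \<open>A\<^sup>i B\<^sup>j\<close> is, up to sign,
  the trace of the word \<open>A B A\<^sup>i B\<^sup>j\<close> for \<open>i\<close> and \<open>j\<close> at most 2. Testing the functional on the rays of
  the second cone leaves linear inequalities on the first cone. The other two prefixes
  follow the same pattern.
\<close>
lemma trace_AB_quad_neg:
  assumes "cone 2 12350 u v w" "cone 2 44000 x y z"
  shows "mat_trace (eval_word 3 A1 B1 [LetA, LetB] * (quad A1 u v w * quad B1 x y z)) < 0"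
proof -
  have "mat_trace (eval_word 3 A1 B1 [LetA, LetB] * (quad A1 u v w * quad B1 x y z)) =
      (- 3164 * u - 330114 * v + 4070398206 * w) * x
      - (47736 * u - 14 * v + 110306 * w) * y
      + (2089017036 * u - 46114 * v + 6 * w) * z"
    unfolding word_AB quad_A1 quad_B1 mat3_simps by (simp add: algebra_simps)
  also have "\<dots> < 0"
    using assms(1) by (intro cone_functional_neg[OF assms(2)]) (auto simp: cone_def)
  finally show ?thesis .
qed

lemma word_ABBAB: "eval_word 3 A1 B1 [LetA, LetB, LetB, LetA, LetB] =
  mat3 109101 (- 11440) 570 (- 2204900) 231204 (- 11520) (- 1951510) 204580 (- 10191)"
  unfolding A1_def B1_def by (simp add: mat3_simps)

lemma trace_ABBAB_quad_neg:
  assumes "cone 2 12350 u v w" "cone 2 44000 x y z"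
  shows "mat_trace (eval_word 3 A1 B1 [LetA, LetB, LetB, LetA, LetB] * (quad A1 u v w * quad B1 x y z)) < 0"
proof -
  have "mat_trace (eval_word 3 A1 B1 [LetA, LetB, LetB, LetA, LetB] * (quad A1 u v w * quad B1 x y z)) =
      (- 511705002 * u - 36412215036 * v + 448979446720514 * w) * x
      - (116098 * u - 988736 * v + 12166877214 * w) * y
      + (- 219049002 * u + 3164 * v + 330114 * w) * z"
    unfolding word_ABBAB quad_A1 quad_B1 mat3_simps by (simp add: algebra_simps)
  also have "\<dots> < 0"
    using assms(1) by (intro cone_functional_neg[OF assms(2)]) (auto simp: cone_def)
  finally show ?thesis .
qed

lemma word_ABAB: "eval_word 3 A1 B1 [LetA, LetB, LetA, LetB] =
  mat3 1 0 0 (- 60) 4 0 320 (- 100) 9"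
  unfolding A1_def B1_def by (simp add: mat3_simps)

lemma trace_ABAB_quad_neg:
  assumes "cone 2 12350 u v w" "cone 2 44000 x y z"
  shows "mat_trace (eval_word 3 A1 B1 [LetA, LetB, LetA, LetB] * (quad A1 u v w * quad B1 x y z)) < 0"
proof -
  have "mat_trace (eval_word 3 A1 B1 [LetA, LetB, LetA, LetB] * (quad A1 u v w * quad B1 x y z)) =
      (- 32302 * u - 988736 * v + 12181614414 * w) * x
      - (50998 * u - 36 * v + 330114 * w) * y
      + (2162350098 * u - 47736 * v + 14 * w) * z"
    unfolding word_ABAB quad_A1 quad_B1 mat3_simps by (simp add: algebra_simps)
  also have "\<dots> < 0"
    using assms(1) by (intro cone_functional_neg[OF assms(2)]) (auto simp: cone_def)
  finally show ?thesis .
qed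

theorem mainTheorem6:
  shows "positive_definite 3 A1 \<and> positive_definite 3 B1 \<and>
    (\<forall>p \<ge> 2. \<forall>q \<ge> 2.
       can_have_negative_trace (word_ABApBq p q) \<and>
       can_have_negative_trace (word_ABBABApBq p q) \<and>
       can_have_negative_trace (word_ABABApBq p q) \<and>
       mat_trace (eval_word 3 A1 B1 (word_ABApBq p q)) < 0 \<and>
       mat_trace (eval_word 3 A1 B1 (word_ABBABApBq p q)) < 0 \<and>
       mat_trace (eval_word 3 A1 B1 (word_ABABApBq p q)) < 0)"
proof -
  have "mat_trace (eval_word 3 A1 B1 (word_ABApBq p q)) < 0"
    and "mat_trace (eval_word 3 A1 B1 (word_ABBABApBq p q)) < 0"
    and "mat_trace (eval_word 3 A1 B1 (word_ABABApBq p q)) < 0" if "p \<ge> 2" "q \<ge> 2" for p q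
    unfolding word_ABApBq_def word_ABBABApBq_def word_ABABApBq_def
    by (rule trace_word_neg[OF that]; rule trace_AB_quad_neg trace_ABBAB_quad_neg
        trace_ABAB_quad_neg; assumption)+
  then show ?thesis
    using positive_definite_A1 positive_definite_B1
    unfolding can_have_negative_trace_def by blast
qed

end
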